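(* Let $N \ge 2$, $W>0$, $\eta>0$, and let $\mathbf{g}$, $\tilde{\mathbf{g}}^{(K)}$, $F_{\max}$, $\tilde F_{\max}^{(K)}$, $P_{\mathrm{out}}$, $\tilde P_{\mathrm{out}}^{(K)}$ be as defined in the context. For any truncation order $K \in \{1,\dots,N\}$ and any threshold $x>0$, $$\tilde F_{\max}^{(K)}(x) \ge F_{\max}(x).$$ Equivalently, $\tilde P_{\mathrm{out}}^{(K)} \ge P_{\mathrm{out}}$ for all $\gamma_{\mathrm{th}}>0$ and $\bar\gamma>0$.
   Context: $\mathbf{R}$ is the $N\times N$ real symmetric positive semidefinite Toeplitz matrix (Jakes correlation matrix) with entries $[\mathbf{R}]_{k,l} = J_0\!\left(\frac{2\pi |k-l| W}{N-1}\right)$, where $J_0$ is the zeroth-order Bessel function of the first kind; so $[\mathbf{R}]_{n,n}=1$. Fix an eigendecomposition $\mathbf{R} = \mathbf{U}\boldsymbol{\Lambda}\mathbf{U}^H$ with $\mathbf{U}=[\mathbf{u}_1,\dots,\mathbf{u}_N]$ unitary with entries $u_{n,k}$, and $\boldsymbol{\Lambda}=\mathrm{diag}(\lambda_1,\dots,\lambda_N)$, $\lambda_1\ge\cdots\ge\lambda_N\ge 0$. Let $z_1,\dots,z_N$ be i.i.d. $\mathcal{CN}(0,1)$ (standard circularly symmetric complex Gaussian). The channel vector is $\mathbf{g} = (g_1,\dots,g_N)^T$ with $g_n = \sqrt{\eta}\sum_{k=1}^N \sqrt{\lambda_k}\,u_{n,k} z_k$, so $\mathbf{g}\sim\mathcal{CN}(\mathbf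 0,\eta\mathbf{R})$. Its $K$-truncated Karhunen-Loève expansion is $\tilde{\mathbf{g}}^{(K)} = (\tilde g_1^{(K)},\dots,\tilde g_N^{(K)})^T$ with $\tilde g_n^{(K)} = \sqrt{\eta}\sum_{k=1}^K \sqrt{\lambda_k}\,u_{n,k} z_k$. Define $F_{\max}(x) = \mathbb{P}(\max_{1\le n\le N} |g_n|^2/\eta \le x)$ and $\tilde F_{\max}^{(K)}(x) = \mathbb{P}(\max_{1\le n\le N} |\tilde g_n^{(K)}|^2/\eta \le x)$. For an SNR threshold $\gamma_{\mathrm{th}}>0$ and average SNR $\bar\gamma>0$, the outage probabilities are $P_{\mathrm{out}} = F_{\max}(\gamma_{\mathrm{th}}/\bar\gamma)$ and $\tilde P_{\mathrm{out}}^{(K)} = \tilde F_{\max}^{(K)}(\gamma_{\mathrm{th}}/\bar\gamma)$. *)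

theory Defs
  imports "HOL-Probability.Probability" "Jordan_Normal_Form.Schur_Decomposition"
begin

definition bessel_J0 :: "real \<Rightarrow> real" where
  "bessel_J0 x = (\<Sum>m. (-1) ^ m / (fact m)\<^sup>2 * (x / 2) ^ (2 * m))"

lemma bessel_J0_sums:
  "(\<lambda>m. (-1) ^ m / (fact m)\<^sup>2 * (x / 2) ^ (2 * m)) sums bessel_J0 x"
proof -
  have "summable (\<lambda>m. (-1) ^ m / (fact m)\<^sup>2 * (x / 2) ^ (2 * m))"
  proof (rule summable_comparison_test)
    show "summable (\<lambda>m. inverse (fact m) * ((x / 2)\<^sup>2) ^ m)"
      by (rule summable_exp)
    have "1 / (fact m)\<^sup>2 \<le> inverse (fact m :: real)" for m
      by (simp add: power2_eq_square field_simps fact_ge_1)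
    then have "1 / (fact m)\<^sup>2 * ((x / 2)\<^sup>2) ^ m \<le> inverse (fact m) * ((x / 2)\<^sup>2) ^ m" for m
      by (intro mult_right_mono) auto
    then show "\<exists>K. \<forall>m\<ge>K. norm ((-1) ^ m / (fact m)\<^sup>2 * (x / 2) ^ (2 * m))
                 \<le> inverse (fact m) * ((x / 2)\<^sup>2) ^ m"
      by (simp add: abs_mult power_mult)
  qed
  then show ?thesis
    unfolding bessel_J0_def by (rule summable_sums)
qed

text \<open>
  Matrix and vector indices run over \<open>0, \<dots>, N - 1\<close> rather than \<open>1, \<dots>, N\<close> throughout.
\<close>

definition jakes_matrix :: "nat \<Rightarrow> real \<Rightarrow> real mat" where
  "jakes_matrix N W =
     Matrix.mat N N (\<lambda>(k, l). bessel_J0 (2 * pi * \<bar>real k - real l\<bar> * W / (real N - 1)))"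

definition unitary_mat :: "nat \<Rightarrow> complex mat \<Rightarrow> bool" where
  "unitary_mat N U \<longleftrightarrow>
     U \<in> carrier_mat N N \<and> mat_adjoint U * U = 1\<^sub>m N \<and> U * mat_adjoint U = 1\<^sub>m N"

definition psd_eigendecomposition ::
    "nat \<Rightarrow> real mat \<Rightarrow> complex mat \<Rightarrow> (nat \<Rightarrow> real) \<Rightarrow> bool" where
  "psd_eigendecomposition N R U lam \<longleftrightarrow>
     unitary_mat N U \<and>
     map_mat complex_of_real R = U * mat_diag N (\<lambda>k. complex_of_real (lam k)) * mat_adjoint U \<and>
     (\<forall>i j. i \<le> j \<and> j < N \<longrightarrow> lam j \<le> lam i) \<and>
     (\<forall>k<N. 0 \<le> lam k)"

text \<open>
  Density of \<open>CN(0,1)\<close>, the standard circularly symmetric complex Gaussian law, normalised so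
  that \<open>E |z|\<^sup>2 = 1\<close>: real and imaginary parts are independent with variance \<open>1/2\<close> each.
\<close>

definition std_complex_normal_density :: "complex \<Rightarrow> real" where
  "std_complex_normal_density w = exp (- (cmod w)\<^sup>2) / pi"

lemma std_complex_normal_density_altdef:
  "std_complex_normal_density w =
     normal_density 0 (sqrt (1 / 2)) (Re w) * normal_density 0 (sqrt (1 / 2)) (Im w)"
  by (simp add: std_complex_normal_density_def normal_density_def cmod_power2
      real_sqrt_divide power_divide exp_add [symmetric])

definition channel ::
    "nat \<Rightarrow> real \<Rightarrow> complex mat \<Rightarrow> (nat \<Rightarrow> real) \<Rightarrow> (nat \<Rightarrow> 'a \<Rightarrow> complex) \<Rightarrow> nat \<Rightarrow> 'a \<Rightarrow> complex"
  where
  "channel N \<eta> U lam z n \<omega> =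
     complex_of_real (sqrt \<eta>) *
       (\<Sum>k<N. complex_of_real (sqrt (lam k)) * U $$ (n, k) * z k \<omega>)"

definition truncated_channel ::
    "nat \<Rightarrow> real \<Rightarrow> complex mat \<Rightarrow> (nat \<Rightarrow> real) \<Rightarrow> (nat \<Rightarrow> 'a \<Rightarrow> complex) \<Rightarrow> nat \<Rightarrow> 'a \<Rightarrow> complex"
  where
  "truncated_channel K \<eta> U lam z n \<omega> =
     complex_of_real (sqrt \<eta>) *
       (\<Sum>k<K. complex_of_real (sqrt (lam k)) * U $$ (n, k) * z k \<omega>)"

definition max_gain_cdf ::
    "'a measure \<Rightarrow> nat \<Rightarrow> real \<Rightarrow> (nat \<Rightarrow> 'a \<Rightarrow> complex) \<Rightarrow> real \<Rightarrow> real" where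
  "max_gain_cdf M N \<eta> h x =
     measure M {\<omega> \<in> space M. Max ((\<lambda>n. (cmod (h n \<omega>))\<^sup>2 / \<eta>) ` {..<N}) \<le> x}"

definition outage_prob ::
    "'a measure \<Rightarrow> nat \<Rightarrow> real \<Rightarrow> (nat \<Rightarrow> 'a \<Rightarrow> complex) \<Rightarrow> real \<Rightarrow> real \<Rightarrow> real" where
  "outage_prob M N \<eta> h \<gamma>\<^sub>t\<^sub>h \<gamma>\<^sub>a\<^sub>v = max_gain_cdf M N \<eta> h (\<gamma>\<^sub>t\<^sub>h / \<gamma>\<^sub>a\<^sub>v)"

end

theory Submission
  imports Defs
begin

text \<open>
  The event that every gain is at most \<open>x\<close> says that a linear image of the independent Gaussians
  \<open>z\<^sub>k\<close> lies in a symmetric convex set \<open>C\<close>, so adding one more summand \<open>z\<^sub>k a\<^sub>k\<close> can only lower its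
  probability (Anderson's inequality): the function \<open>H s = P (S + s \<in> C)\<close> is even and midpoint
  log-concave, so \<open>(H s)\<^sup>2 = H s * H (- s) \<le> (H 0)\<^sup>2\<close>, and averaging \<open>H\<close> over
  \<open>s = z\<^sub>k a\<^sub>k\<close> gives at most \<open>H 0\<close>. Log-concavity survives each Gaussian average by the
  Prekopa--Leindler inequality, whose one-dimensional case follows from Brunn--Minkowski for
  the superlevel sets and the layer cake formula.
\<close>

subsection \<open>The Prekopa--Leindler inequality\<close>

lemma emeasure_lborel_translate:
  fixes A :: "real set"
  assumes "A \<in> sets borel"
  shows "emeasure lborel {x. x - c \<in> A} = emeasure lborel A"
proof -
  have [measurable]: "A \<in> sets borel" by fact
  have "emeasure lborel A = (\<integral>\<^sup>+x. indicator A x \<partial>lborel)" by simp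
  also have "\<dots> = (\<integral>\<^sup>+x. indicator A (- c + 1 * x) \<partial>lborel)"
    by (subst nn_integral_real_affine[where c=1 and t="-c"]) auto
  also have "\<dots> = (\<integral>\<^sup>+x. indicator {x. x - c \<in> A} x \<partial>lborel)"
    by (intro nn_integral_cong) (auto simp: indicator_def)
  also have "\<dots> = emeasure lborel {x. x - c \<in> A}" by (subst nn_integral_indicator) simp_all
  finally show ?thesis by simp
qed

text \<open>If \<open>A\<close> had a greatest and \<open>B\<close> a least element, the translates
  \<open>A + min B\<close> and \<open>max A + B\<close> would both lie in \<open>C\<close> and meet
  in at most one point. The extrema need not be attained, so nearly extremal points replace them and
  the overlap costs at most \<open>e\<close>.\<close>

lemma brunn_minkowski_bounded:
  fixes A B C :: "real set"
  assumes meas: "A \<in> sets borel" "B \<in> sets borel" "C \<in> sets borel"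
    and ne: "A \<noteq> {}" "B \<noteq> {}" and bdd: "bdd_above A" "bdd_below B"
    and sub: "\<And>a b. a \<in> A \<Longrightarrow> b \<in> B \<Longrightarrow> a + b \<in> C"
  shows "emeasure lborel A + emeasure lborel B \<le> emeasure lborel C"
proof (rule ennreal_le_epsilon)
  fix e :: real assume e: "0 < e"
  note [measurable] = meas
  obtain a where a: "a \<in> A" "Sup A - e / 2 < a"
    using less_cSup_iff[OF ne(1) bdd(1), of "Sup A - e / 2"] e by auto
  obtain b where b: "b \<in> B" "b < Inf B + e / 2"
    using cInf_less_iff[OF ne(2) bdd(2), of "Inf B + e / 2"] e by auto
  define S where "S = {x. x - b \<in> A}"
  define T where "T = {x. x - a \<in> B}"
  have [measurable]: "S \<in> sets borel" "T \<in> sets borel" by (auto simp: S_def T_def)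
  have "S \<subseteq> C" "T \<subseteq> C"
    using sub[OF _ b(1)] sub[OF a(1)] by (auto simp: S_def T_def) (metis add.commute diff_add_cancel, metis add.commute diff_add_cancel)
  \<comment> \<open>Both translates of \<open>A\<close> and \<open>B\<close> lie in \<open>C\<close>, and they overlap only around \<open>Sup A + Inf B\<close>.\<close>
  have "S \<inter> T \<subseteq> {a + Inf B..Sup A + b}"
    using cSup_upper[OF _ bdd(1)] cInf_lower[OF _ bdd(2)] by (fastforce simp: S_def T_def)
  then have "emeasure lborel (S \<inter> T) \<le> emeasure lborel {a + Inf B..Sup A + b}"
    by (intro emeasure_mono) auto
  also have "\<dots> \<le> ennreal e"
    using a b cSup_upper[OF a(1) bdd(1)] cInf_lower[OF b(1) bdd(2)]
    by (subst emeasure_lborel_Icc) (auto intro!: ennreal_leI)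
  finally have ST: "emeasure lborel (S \<inter> T) \<le> ennreal e" .
  have "emeasure lborel A + emeasure lborel B = emeasure lborel S + emeasure lborel T"
    by (simp add: S_def T_def emeasure_lborel_translate meas)
  also have "\<dots> = emeasure lborel (S \<union> T) + emeasure lborel (S \<inter> T)"
    by (rule emeasure_Un_Int) auto
  also have "\<dots> \<le> emeasure lborel C + ennreal e"
    using \<open>S \<subseteq> C\<close> \<open>T \<subseteq> C\<close> ST by (intro add_mono emeasure_mono) auto
  finally show "emeasure lborel A + emeasure lborel B \<le> emeasure lborel C + ennreal e" .
qed

text \<open>Boundedness is removed by cutting both sets down to growing intervals, along which
  Lebesgue measure is continuous from below.\<close>

lemma brunn_minkowski_real:
  fixes A B C :: "real set"
  assumes meas: "A \<in> sets borel" "B \<in> sets borel" "C \<in> sets borel"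
    and ne: "A \<noteq> {}" "B \<noteq> {}"
    and sub: "\<And>a b. a \<in> A \<Longrightarrow> b \<in> B \<Longrightarrow> a + b \<in> C"
  shows "emeasure lborel A + emeasure lborel B \<le> emeasure lborel C"
proof -
  note [measurable] = meas
  obtain a b where ab: "a \<in> A" "b \<in> B" using ne by auto
  define A' where "A' n = A \<inter> {- real n..real n}" for n
  define B' where "B' n = B \<inter> {- real n..real n}" for n
  have inc: "incseq A'" "incseq B'" by (force simp: incseq_def A'_def B'_def)+
  have un: "(\<Union>n. A' n) = A" "(\<Union>n. B' n) = B"
    unfolding A'_def B'_def using real_arch_simple[of "\<bar>x\<bar>" for x] by (force simp: abs_le_iff)+
  have [measurable]: "A' n \<in> sets borel" "B' n \<in> sets borel" for n by (auto simp: A'_def B'_def)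
  have "emeasure lborel A + emeasure lborel B
      = (SUP n. emeasure lborel (A' n)) + (SUP n. emeasure lborel (B' n))"
    using inc by (subst (1 2) SUP_emeasure_incseq) (auto simp: un)
  also have "\<dots> = (SUP n. emeasure lborel (A' n) + emeasure lborel (B' n))"
    using inc by (intro ennreal_SUP_add[symmetric]) (simp_all add: incseq_def emeasure_mono)
  also have "\<dots> \<le> emeasure lborel C"
  proof (rule SUP_least)
    \<comment> \<open>The bounded case needs nonempty sets, so the window is enlarged from
      \<open>n\<close> to an \<open>m\<close> that is certain to catch the points \<open>a\<close>
      and \<open>b\<close>.\<close>
    fix n
    obtain m where m: "\<bar>a\<bar> \<le> real m" "\<bar>b\<bar> \<le> real m" "n \<le> m"
      by (metis linorder_le_cases max.bounded_iff order_trans real_arch_simple of_nat_le_iff)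
    have "emeasure lborel (A' n) + emeasure lborel (B' n)
        \<le> emeasure lborel (A' m) + emeasure lborel (B' m)"
      using inc m(3) by (intro add_mono emeasure_mono) (auto simp: incseq_def)
    also have "\<dots> \<le> emeasure lborel C"
    proof (rule brunn_minkowski_bounded)
      show "A' m \<noteq> {}" "B' m \<noteq> {}" using ab m by (auto simp: A'_def B'_def abs_le_iff)
      show "bdd_above (A' m)" "bdd_below (B' m)"
        unfolding A'_def B'_def by (auto intro!: bdd_above_Int2 bdd_below_Int2)
      show "x + y \<in> C" if "x \<in> A' m" "y \<in> B' m" for x y
        using that sub by (auto simp: A'_def B'_def)
    qed auto
    finally show "emeasure lborel (A' n) + emeasure lborel (B' n) \<le> emeasure lborel C" .
  qed
  finally show ?thesis .
qed

section \<open>Prekopa--Leindler on the real line\<close>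

text \<open>The value \<open>f x\<close> is the length of the set of levels \<open>t\<close> below
  it, and Tonelli swaps levels and points. Levels are confined to (0,1) because superlevel sets of a
  function with supremum 1 are guaranteed to be nonempty only there.\<close>

lemma nn_integral_layer_cake_le_1:
  fixes f :: "real \<Rightarrow> ennreal"
  assumes [measurable]: "f \<in> borel_measurable borel" and "\<And>x. f x \<le> 1"
  shows "(\<integral>\<^sup>+x. f x \<partial>lborel)
       = (\<integral>\<^sup>+t. indicator {0<..<1} t * emeasure lborel {x. ennreal t < f x} \<partial>lborel)"
proof -
  have "(\<integral>\<^sup>+t. indicator {0<..<1} t * indicator {x. ennreal t < f x} x \<partial>lborel) = f x" for x
  proof -
    obtain r where r: "f x = ennreal r" "0 \<le> r" "r \<le> 1"
      using assms(2)[of x] by (cases "f x") (auto simp: ennreal_le_1 top_unique)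
    have "(\<integral>\<^sup>+t. indicator {0<..<1} t * indicator {x. ennreal t < f x} x \<partial>lborel)
        = (\<integral>\<^sup>+t. indicator {0<..<r} t \<partial>lborel)"
      using r by (intro nn_integral_cong) (auto simp: indicator_def ennreal_less_iff)
    then show ?thesis using r by simp
  qed
  then have "(\<integral>\<^sup>+x. f x \<partial>lborel)
      = (\<integral>\<^sup>+x. \<integral>\<^sup>+t. indicator {0<..<1} t * indicator {x. ennreal t < f x} x \<partial>lborel \<partial>lborel)"
    by simp
  also have "\<dots> = (\<integral>\<^sup>+t. \<integral>\<^sup>+x. indicator {0<..<1} t * indicator {x. ennreal t < f x} x \<partial>lborel \<partial>lborel)"
    by (rule lborel_pair.Fubini') (simp add: indicator_def, measurable)
  also have "\<dots> = (\<integral>\<^sup>+t. indicator {0<..<1} t * emeasure lborel {x. ennreal t < f x} \<partial>lborel)"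
    by (intro nn_integral_cong) (simp add: nn_integral_cmult)
  finally show ?thesis .
qed

text \<open>With both suprema equal to 1, the superlevel sets of \<open>f\<close> and
  \<open>g\<close> at any level in (0,1) are nonempty, and their sums land in the superlevel set of
  \<open>h\<close> at the same level. Integrating Brunn--Minkowski over the levels gives an additive
  bound.\<close>

lemma prekopa_leindler_normalized:
  fixes f g h :: "real \<Rightarrow> ennreal"
  assumes [measurable]: "f \<in> borel_measurable borel" "g \<in> borel_measurable borel"
      "h \<in> borel_measurable borel"
    and sup: "(SUP x. f x) = 1" "(SUP x. g x) = 1"
    and le: "\<And>x y. f x * g y \<le> (h (x + y))\<^sup>2"
  shows "(\<integral>\<^sup>+x. f x \<partial>lborel) + (\<integral>\<^sup>+x. g x \<partial>lborel) \<le> (\<integral>\<^sup>+x. h x \<partial>lborel)"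
proof -
  \<comment> \<open>The layer cake formula needs values at most 1. Capping \<open>h\<close>
    preserves the hypothesis because \<open>f x * g y\<close> never exceeds 1.\<close>
  define k where "k x = min 1 (h x)" for x
  have [measurable]: "k \<in> borel_measurable borel" by (simp add: k_def[abs_def])
  have le1: "f x \<le> 1" "g x \<le> 1" "k x \<le> 1" for x
    using SUP_upper[of x UNIV f] SUP_upper[of x UNIV g] by (auto simp: sup k_def)
  have "f x * g y \<le> 1" for x y using mult_mono[OF le1(1)[of x] le1(2)[of y]] by simp
  then have lek: "f x * g y \<le> (k (x + y))\<^sup>2" for x y using le[of x y] by (auto simp: k_def min_def)
  have "(\<integral>\<^sup>+x. f x \<partial>lborel) + (\<integral>\<^sup>+x. g x \<partial>lborel)
     = (\<integral>\<^sup>+t. indicator {0<..<1} t * (emeasure lborel {x. ennreal t < f x} + emeasure lborel {x. ennreal t < g x}) \<partial>lborel)"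
    by (simp add: nn_integral_layer_cake_le_1 le1 distrib_left nn_integral_add)
  also have "\<dots> \<le> (\<integral>\<^sup>+t. indicator {0<..<1} t * emeasure lborel {x. ennreal t < k x} \<partial>lborel)"
  proof (intro nn_integral_mono)
    fix t :: real
    have "emeasure lborel {x. ennreal t < f x} + emeasure lborel {x. ennreal t < g x}
       \<le> emeasure lborel {x. ennreal t < k x}" if t: "0 < t" "t < 1"
    proof (rule brunn_minkowski_real)
      have "ennreal t < 1" using t by (simp add: ennreal_less_one_iff)
      then show "{x. ennreal t < f x} \<noteq> {}" "{x. ennreal t < g x} \<noteq> {}"
        using less_SUP_iff[of "ennreal t" f UNIV] less_SUP_iff[of "ennreal t" g UNIV] sup by auto
      fix x y assume "x \<in> {x. ennreal t < f x}" "y \<in> {x. ennreal t < g x}"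
      then have "ennreal t * ennreal t < f x * ennreal t" "f x * ennreal t \<le> f x * g y"
        using t by (auto intro!: ennreal_mult_strict_right_mono mult_left_mono)
      then have "ennreal t * ennreal t < f x * g y" by (rule less_le_trans)
      also have "\<dots> \<le> (k (x + y))\<^sup>2" by (rule lek)
      finally have "\<not> k (x + y) \<le> ennreal t"
        by (metis leD mult_mono power2_eq_square zero_le)
      then show "x + y \<in> {x. ennreal t < k x}" by simp
    qed auto
    then show "indicator {0<..<1} t * (emeasure lborel {x. ennreal t < f x} + emeasure lborel {x. ennreal t < g x})
       \<le> indicator {0<..<1} t * emeasure lborel {x. ennreal t < k x}"
      by (auto simp: indicator_def)
  qed
  also have "\<dots> = (\<integral>\<^sup>+x. k x \<partial>lborel)" by (simp add: nn_integral_layer_cake_le_1 le1)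
  also have "\<dots> \<le> (\<integral>\<^sup>+x. h x \<partial>lborel)" by (intro nn_integral_mono) (simp add: k_def)
  finally show ?thesis .
qed

text \<open>A function with supremum 0 vanishes, which settles that case. Otherwise boundedness
  makes the suprema finite and positive, so \<open>f\<close> and \<open>g\<close> can be divided by
  them to reach the normalized case.\<close>

lemma prekopa_leindler_bounded:
  fixes f g h :: "real \<Rightarrow> ennreal" and c :: real
  assumes [measurable]: "f \<in> borel_measurable borel" "g \<in> borel_measurable borel"
      "h \<in> borel_measurable borel"
    and bdd: "\<And>x. f x \<le> ennreal c" "\<And>x. g x \<le> ennreal c"
    and le: "\<And>x y. f x * g y \<le> (h ((x + y) / 2))\<^sup>2"
  shows "(\<integral>\<^sup>+x. f x \<partial>lborel) * (\<integral>\<^sup>+x. g x \<partial>lborel) \<le> (\<integral>\<^sup>+x. h x \<partial>lborel)\<^sup>2"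
proof (cases "(SUP x. f x) = 0 \<or> (SUP x. g x) = 0")
  case True
  then have "(\<forall>x. f x = 0) \<or> (\<forall>x. g x = 0)"
    by (simp add: SUP_bot_conv flip: bot_ennreal)
  then show ?thesis by auto
next
  case False
  have "(SUP x. f x) \<le> ennreal c" "(SUP x. g x) \<le> ennreal c" using bdd by (auto intro: SUP_least)
  moreover have "\<exists>a>0. s = ennreal a" if "s \<le> ennreal c" "s \<noteq> 0" for s
    using that by (cases s) (auto simp: top_unique less_le)
  ultimately obtain a b
    where ab: "(SUP x. f x) = ennreal a" "(SUP x. g x) = ennreal b" "0 < a" "0 < b"
    using False by meson
  \<comment> \<open>The factor \<open>w\<close> for \<open>h\<close> is the geometric mean of
    \<open>u\<close> and \<open>v\<close>, so the pointwise hypothesis survives the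
    rescaling.\<close>
  define u v w where "u = ennreal (1 / a)" and "v = ennreal (1 / b)" and "w = ennreal (1 / sqrt (a * b))"
  have "1 / sqrt (a * b) * (1 / sqrt (a * b)) = 1 / (a * b)"
    using ab by (simp add: real_sqrt_mult_self field_simps)
  then have w2: "w\<^sup>2 = u * v"
    using ab by (simp add: u_def v_def w_def power2_eq_square flip: ennreal_mult)
  have uv: "u * v \<noteq> 0" "u * v \<noteq> \<infinity>"
    using ab by (simp_all add: u_def v_def flip: ennreal_mult)
  define F G H where "F = (\<integral>\<^sup>+x. f x \<partial>lborel)" and "G = (\<integral>\<^sup>+x. g x \<partial>lborel)" and "H = (\<integral>\<^sup>+x. h x \<partial>lborel)"
  have "(\<integral>\<^sup>+x. u * f x \<partial>lborel) + (\<integral>\<^sup>+x. v * g x \<partial>lborel) \<le> (\<integral>\<^sup>+x. w * h (x / 2) \<partial>lborel)"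
  proof (rule prekopa_leindler_normalized)
    show "(SUP x. u * f x) = 1" "(SUP x. v * g x) = 1"
      unfolding SUP_mult_left_ennreal[symmetric] ab using ab
      by (simp_all add: u_def v_def flip: ennreal_mult)
    show "u * f x * (v * g y) \<le> (w * h ((x + y) / 2))\<^sup>2" for x y
      using mult_left_mono[OF le[of x y], of "u * v"] by (simp add: power_mult_distrib w2 mult_ac)
  qed auto
  \<comment> \<open>Replacing \<open>h\<close> by its dilation turned the midpoint into a sum. The
    dilation contributes the factor 2, whose square later cancels the 4 of AM-GM.\<close>
  also have "(\<integral>\<^sup>+x. w * h (x / 2) \<partial>lborel) = w * (2 * H)"
    unfolding H_def by (subst nn_integral_real_affine[where c=2 and t=0]) (auto simp: nn_integral_cmult mult_ac)
  finally have "u * F + v * G \<le> 2 * (w * H)"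
    by (simp add: F_def G_def nn_integral_cmult mult_ac)
  then have "(u * F + v * G)\<^sup>2 \<le> (2 * (w * H))\<^sup>2" by (rule power_mono_ennreal)
  \<comment> \<open>AM-GM, to return from the normalized additive inequality to the product form\<close>
  moreover have "4 * ((u * F) * (v * G)) \<le> (u * F + v * G)\<^sup>2"
  proof (cases "u * F"; cases "v * G")
    fix r s assume "u * F = ennreal r" "v * G = ennreal s" "0 \<le> r" "0 \<le> s"
    moreover have "4 * (r * s) \<le> (r + s)\<^sup>2" using sum_squares_ge_zero[of "r - s" 0]
      by (simp add: power2_eq_square algebra_simps)
    ultimately show ?thesis
      by (simp add: ennreal_power ennreal_leI flip: ennreal_mult ennreal_plus ennreal_numeral)
  qed (auto simp: ennreal_top_eq_mult_iff top_power_ennreal)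
  ultimately have "4 * ((u * F) * (v * G)) \<le> (2 * (w * H))\<^sup>2" by (rule order_trans[rotated])
  then have "(4 * (u * v)) * (F * G) \<le> (4 * (u * v)) * H\<^sup>2"
    by (simp add: power_mult_distrib w2 mult_ac)
  then show ?thesis
    using uv unfolding F_def G_def H_def by (subst (asm) ennreal_mult_le_mult_iff) (auto simp: ennreal_mult_eq_top_iff)
qed

text \<open>Lowering \<open>f\<close> and \<open>g\<close> by truncation keeps the hypothesis, and
  monotone convergence recovers the integrals. The truncation heights are independent of each other,
  so the product of the two suprema can be bounded one supremum at a time.\<close>

theorem prekopa_leindler_real:
  fixes f g h :: "real \<Rightarrow> ennreal"
  assumes [measurable]: "f \<in> borel_measurable borel" "g \<in> borel_measurable borel"
      "h \<in> borel_measurable borel"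
    and le: "\<And>x y. f x * g y \<le> (h ((x + y) / 2))\<^sup>2"
  shows "(\<integral>\<^sup>+x. f x \<partial>lborel) * (\<integral>\<^sup>+x. g x \<partial>lborel) \<le> (\<integral>\<^sup>+x. h x \<partial>lborel)\<^sup>2"
proof -
  have trunc: "(\<integral>\<^sup>+x. k x \<partial>lborel) = (SUP n. \<integral>\<^sup>+x. min (k x) (of_nat n) \<partial>lborel)"
    if [measurable]: "k \<in> borel_measurable borel" for k :: "real \<Rightarrow> ennreal"
  proof -
    have "(SUP n. min (k x) (of_nat n)) = k x" for x
      using inf_SUP[of "k x" of_nat UNIV] by (simp add: ennreal_SUP_of_nat_eq_top inf_min)
    then have "(\<integral>\<^sup>+x. k x \<partial>lborel) = (\<integral>\<^sup>+x. (SUP n. min (k x) (of_nat n)) \<partial>lborel)" by simp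
    also have "\<dots> = (SUP n. \<integral>\<^sup>+x. min (k x) (of_nat n) \<partial>lborel)"
      by (rule nn_integral_monotone_convergence_SUP)
         (auto simp: incseq_def le_fun_def intro!: min.mono min.coboundedI2)
    finally show ?thesis .
  qed
  have "(\<integral>\<^sup>+x. min (f x) (of_nat n) \<partial>lborel) * (\<integral>\<^sup>+x. min (g x) (of_nat m) \<partial>lborel)
      \<le> (\<integral>\<^sup>+x. h x \<partial>lborel)\<^sup>2" for n m
  proof (rule prekopa_leindler_bounded)
    show "min (f x) (of_nat n) \<le> ennreal (real (max n m))" for x
      by (rule order_trans[OF min.cobounded2]) (simp add: ennreal_of_nat_eq_real_of_nat)
    show "min (g x) (of_nat m) \<le> ennreal (real (max n m))" for x
      by (rule order_trans[OF min.cobounded2]) (simp add: ennreal_of_nat_eq_real_of_nat)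
    show "min (f x) (of_nat n) * min (g y) (of_nat m) \<le> (h ((x + y) / 2))\<^sup>2" for x y
      by (rule order_trans[OF mult_mono le]) auto
  qed auto
  then show ?thesis
    by (simp add: trunc[of f] trunc[of g] SUP_mult_left_ennreal SUP_mult_right_ennreal SUP_le_iff)
qed

section \<open>From the line to the complex plane\<close>

lemma Complex_measurable [measurable]:
  "(\<lambda>p. Complex (fst p) (snd p)) \<in> borel_measurable (borel \<Otimes>\<^sub>M borel)"
  unfolding borel_prod by (intro borel_measurable_continuous_onI continuous_intros)

text \<open>Lebesgue measure is determined by its values on boxes, and a complex box is a product of
  intervals in the real and imaginary parts. This opens the way to iterated integration.\<close>

lemma lborel_complex:
  "(lborel :: complex measure) = distr (lborel \<Otimes>\<^sub>M lborel) borel (\<lambda>p. Complex (fst p) (snd p))"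
proof (rule lborel_eqI)
  fix l u :: complex
  assume le: "\<And>b. b \<in> Basis \<Longrightarrow> l \<bullet> b \<le> u \<bullet> b"
  have *: "(\<lambda>p. Complex (fst p) (snd p)) -` box l u \<inter> space (lborel \<Otimes>\<^sub>M lborel)
      = {Re l<..<Re u} \<times> {Im l<..<Im u}"
    by (auto simp: box_def Basis_complex_def space_pair_measure)
  show "emeasure (distr (lborel \<Otimes>\<^sub>M lborel) borel (\<lambda>p. Complex (fst p) (snd p))) (box l u)
      = (\<Prod>b\<in>Basis. (u - l) \<bullet> b)"
    using le[of 1] le[of \<i>] by (subst emeasure_distr)
      (auto simp: * lborel.emeasure_pair_measure_Times Basis_complex_def simp flip: ennreal_mult)
qed simp

lemma nn_integral_lborel_complex:
  fixes f :: "complex \<Rightarrow> ennreal"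
  assumes [measurable]: "f \<in> borel_measurable borel"
  shows "(\<integral>\<^sup>+w. f w \<partial>lborel) = (\<integral>\<^sup>+x. \<integral>\<^sup>+y. f (Complex x y) \<partial>lborel \<partial>lborel)"
  by (subst lborel_complex) (simp add: nn_integral_distr lborel.nn_integral_fst[symmetric])

lemma prekopa_leindler_complex:
  fixes f g h :: "complex \<Rightarrow> ennreal"
  assumes [measurable]: "f \<in> borel_measurable borel" "g \<in> borel_measurable borel"
      "h \<in> borel_measurable borel"
    and le: "\<And>x y. f x * g y \<le> (h ((x + y) / 2))\<^sup>2"
  shows "(\<integral>\<^sup>+x. f x \<partial>lborel) * (\<integral>\<^sup>+x. g x \<partial>lborel) \<le> (\<integral>\<^sup>+x. h x \<partial>lborel)\<^sup>2"
proof -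
  have m[measurable]: "(\<lambda>(x, y). k (Complex x y)) \<in> borel_measurable (borel \<Otimes>\<^sub>M borel)"
    if [measurable]: "k \<in> borel_measurable borel" for k :: "complex \<Rightarrow> ennreal"
    unfolding split_beta by measurable
  have m1[measurable]: "(\<lambda>y. k (Complex x y)) \<in> borel_measurable borel"
    if [measurable]: "k \<in> borel_measurable borel" for k :: "complex \<Rightarrow> ennreal" and x
    using measurable_compose[OF measurable_Pair1' m[OF that]] by simp
  have m2[measurable]: "(\<lambda>x. \<integral>\<^sup>+y. k (Complex x y) \<partial>lborel) \<in> borel_measurable borel"
    if [measurable]: "k \<in> borel_measurable borel" for k :: "complex \<Rightarrow> ennreal"
    using m[OF that] by (intro lborel.borel_measurable_nn_integral) (simp cong: measurable_cong_sets)
  show ?thesis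
    unfolding nn_integral_lborel_complex[OF assms(1)] nn_integral_lborel_complex[OF assms(2)]
      nn_integral_lborel_complex[OF assms(3)]
  \<comment> \<open>The real inequality is used twice: in the imaginary parts with the real parts
    fixed, which yields exactly the hypothesis for the marginals, and then in the real
    parts.\<close>
  proof (intro prekopa_leindler_real m2 m1 assms)
    show "f (Complex x y) * g (Complex x' y') \<le> (h (Complex ((x + x') / 2) ((y + y') / 2)))\<^sup>2"
      for x y x' y'
    proof -
      have "Complex ((x + x') / 2) ((y + y') / 2) = (Complex x y + Complex x' y') / 2"
        by (simp add: complex_eq_iff)
      then show ?thesis using le by metis
    qed
  qed
qed

subsection \<open>Anderson's inequality for complex Gaussians\<close>

abbreviation std_complex_normal :: "complex measure" where
  "std_complex_normal \<equiv> density lborel (\<lambda>w. ennreal (std_complex_normal_density w))"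

lemma std_complex_normal_density_measurable [measurable]:
  "std_complex_normal_density \<in> borel_measurable borel"
  unfolding std_complex_normal_density_def[abs_def] by measurable

lemma prob_space_std_complex_normal: "prob_space std_complex_normal"
proof
  have normal: "(\<integral>\<^sup>+x. ennreal (normal_density 0 (sqrt (1 / 2)) x) \<partial>lborel) = 1"
    using prob_space.emeasure_space_1[OF prob_space_normal_density[of "sqrt (1 / 2)" 0]]
    by (simp add: emeasure_density)
  have "(\<integral>\<^sup>+w. ennreal (std_complex_normal_density w) \<partial>lborel)
    = (\<integral>\<^sup>+x. ennreal (normal_density 0 (sqrt (1 / 2)) x) *
        (\<integral>\<^sup>+y. ennreal (normal_density 0 (sqrt (1 / 2)) y) \<partial>lborel) \<partial>lborel)"
    by (simp add: nn_integral_lborel_complex std_complex_normal_density_altdef ennreal_mult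
        flip: nn_integral_cmult)
  also have "\<dots> = 1" by (simp add: normal)
  finally show "emeasure std_complex_normal (space std_complex_normal) = 1"
    by (simp add: emeasure_density)
qed

lemma nn_integral_std_complex_normal_uminus:
  fixes f :: "complex \<Rightarrow> ennreal"
  assumes [measurable]: "f \<in> borel_measurable borel"
  shows "(\<integral>\<^sup>+w. f (- w) \<partial>std_complex_normal) = (\<integral>\<^sup>+w. f w \<partial>std_complex_normal)"
proof -
  have "(lborel :: complex measure) = distr lborel borel (\<lambda>w. - w)"
    using lborel_affine[of "-1" "0 :: complex"] by (simp add: density_1)
  then have "(\<integral>\<^sup>+w. ennreal (std_complex_normal_density w) * f w \<partial>lborel)
      = (\<integral>\<^sup>+w. ennreal (std_complex_normal_density w) * f w \<partial>distr lborel borel uminus)"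
    by simp
  also have "\<dots> = (\<integral>\<^sup>+w. ennreal (std_complex_normal_density w) * f (- w) \<partial>lborel)"
    by (subst nn_integral_distr) (auto simp: std_complex_normal_density_def)
  finally show ?thesis by (simp add: nn_integral_density)
qed

lemma std_complex_normal_density_log_concave:
  "std_complex_normal_density x * std_complex_normal_density y
    \<le> (std_complex_normal_density ((x + y) / 2))\<^sup>2"
proof -
  \<comment> \<open>By the parallelogram law the two sides differ by half the squared modulus of
    \<open>x - y\<close>.\<close>
  have "2 * (cmod ((x + y) / 2))\<^sup>2 \<le> (cmod x)\<^sup>2 + (cmod y)\<^sup>2"
    using sum_squares_ge_zero[of "Re x - Re y" "Im x - Im y"]
    unfolding cmod_power2 by (simp add: power2_eq_square field_simps)
  then have "exp (- (cmod x)\<^sup>2 - (cmod y)\<^sup>2) \<le> exp (2 * - (cmod ((x + y) / 2))\<^sup>2)"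
    by simp
  then show ?thesis
    by (simp add: std_complex_normal_density_def power2_eq_square field_simps mult_exp_exp)
qed

text \<open>The density is itself midpoint log-concave, so it can be absorbed into the three
  functions and Lebesgue measure replaced by the Gaussian law.\<close>

lemma prekopa_leindler_std_complex_normal:
  fixes f g h :: "complex \<Rightarrow> ennreal"
  assumes [measurable]: "f \<in> borel_measurable borel" "g \<in> borel_measurable borel"
      "h \<in> borel_measurable borel"
    and le: "\<And>x y. f x * g y \<le> (h ((x + y) / 2))\<^sup>2"
  shows "(\<integral>\<^sup>+x. f x \<partial>std_complex_normal) * (\<integral>\<^sup>+x. g x \<partial>std_complex_normal)
      \<le> (\<integral>\<^sup>+x. h x \<partial>std_complex_normal)\<^sup>2"
proof -
  let ?d = "\<lambda>w. ennreal (std_complex_normal_density w)"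
  have "(\<integral>\<^sup>+x. ?d x * f x \<partial>lborel) * (\<integral>\<^sup>+x. ?d x * g x \<partial>lborel) \<le> (\<integral>\<^sup>+x. ?d x * h x \<partial>lborel)\<^sup>2"
  proof (rule prekopa_leindler_complex)
    fix x y
    have nonneg: "0 \<le> std_complex_normal_density w" for w
      by (simp add: std_complex_normal_density_def)
    have "?d x * ?d y \<le> (?d ((x + y) / 2))\<^sup>2"
      using std_complex_normal_density_log_concave[of x y]
      by (simp add: ennreal_power nonneg flip: ennreal_mult)
    from mult_mono[OF this le[of x y]]
    show "?d x * f x * (?d y * g y) \<le> (?d ((x + y) / 2) * h ((x + y) / 2))\<^sup>2"
      by (simp add: power_mult_distrib mult_ac)
  qed auto
  then show ?thesis by (simp add: nn_integral_density)
qed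

section \<open>Even log-concave functions and Gaussian averages\<close>

text \<open>Log-concavity is written without logarithms so that the value 0 is allowed and
  indicators of convex sets qualify. Over a countable index type, Borel measurability of a map into
  the function space can be checked coordinatewise.\<close>

definition even_log_concave :: "(('i::countable \<Rightarrow> complex) \<Rightarrow> ennreal) \<Rightarrow> bool" where
  "even_log_concave H \<longleftrightarrow> H \<in> borel_measurable borel \<and> (\<forall>s. H (\<lambda>n. - s n) = H s) \<and>
     (\<forall>s t. H s * H t \<le> (H (\<lambda>n. (s n + t n) / 2))\<^sup>2)"

lemma even_log_concave_indicator:
  assumes "C \<in> sets borel" "\<And>s. s \<in> C \<Longrightarrow> (\<lambda>n. - s n) \<in> C"
    and "\<And>s t. s \<in> C \<Longrightarrow> t \<in> C \<Longrightarrow> (\<lambda>n. (s n + t n) / 2) \<in> C"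
  shows "even_log_concave (indicator C)"
proof -
  have "(\<lambda>n. - s n) \<in> C \<longleftrightarrow> s \<in> C" for s using assms(2)[of s] assms(2)[of "\<lambda>n. - s n"] by auto
  then show ?thesis using assms by (auto simp: even_log_concave_def indicator_def)
qed

lemma even_log_concave_le_origin:
  assumes "even_log_concave H"
  shows "H s \<le> H (\<lambda>_. 0)"
proof (rule ccontr)
  assume "\<not> ?thesis"
  then have "H (\<lambda>_. 0) < H s" by simp
  then have "(H (\<lambda>_. 0))\<^sup>2 < (H s)\<^sup>2"
    by (cases "H (\<lambda>_. 0)"; cases "H s")
       (auto simp: ennreal_power ennreal_less_iff top_power_ennreal power_strict_mono)
  moreover have "H s * H s \<le> (H (\<lambda>n. (s n + - s n) / 2))\<^sup>2"
    using assms unfolding even_log_concave_def by metis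
  ultimately show False by (simp add: power2_eq_square)
qed

lemma borel_measurable_affine_fun [measurable]:
  fixes a :: "'i::countable \<Rightarrow> complex"
  shows "(\<lambda>p. \<lambda>n. fst p n + snd p * a n) \<in> borel_measurable (borel \<Otimes>\<^sub>M borel)"
proof (rule measurable_coordinatewise_then_product)
  fix n
  have [measurable]: "(\<lambda>s::'i \<Rightarrow> complex. s n) \<in> borel_measurable borel"
    by (rule measurable_product_coordinates)
  show "(\<lambda>p. fst p n + snd p * a n) \<in> borel_measurable (borel \<Otimes>\<^sub>M borel)" by measurable
qed

text \<open>Evenness comes from the symmetry of the law of \<open>w\<close>. Log-concavity is
  Prekopa--Leindler in the single variable \<open>w\<close>, since the midpoint of
  \<open>s + x * a\<close> and \<open>t + y * a\<close> is the midpoint of \<open>s\<close> and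
  \<open>t\<close> shifted by \<open>(x + y) / 2 * a\<close>.\<close>

lemma even_log_concave_convolution:
  assumes "even_log_concave H"
  shows "even_log_concave (\<lambda>s. \<integral>\<^sup>+w. H (\<lambda>n. s n + w * a n) \<partial>std_complex_normal)"
proof -
  have [measurable]: "H \<in> borel_measurable borel" and even: "\<And>s. H (\<lambda>n. - s n) = H s"
    and lc: "\<And>s t. H s * H t \<le> (H (\<lambda>n. (s n + t n) / 2))\<^sup>2"
    using assms by (auto simp: even_log_concave_def)
  interpret prob_space std_complex_normal by (rule prob_space_std_complex_normal)
  have joint: "(\<lambda>(s, w). H (\<lambda>n. s n + w * a n)) \<in> borel_measurable (borel \<Otimes>\<^sub>M borel)"
    unfolding split_beta by measurable
  have slice [measurable]: "(\<lambda>w. H (\<lambda>n. s n + w * a n)) \<in> borel_measurable borel" for s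
    using measurable_compose[OF measurable_Pair1' joint, of s] by simp
  show ?thesis
    unfolding even_log_concave_def
  proof (intro conjI allI)
    show "(\<lambda>s. \<integral>\<^sup>+w. H (\<lambda>n. s n + w * a n) \<partial>std_complex_normal) \<in> borel_measurable borel"
      using joint by (intro borel_measurable_nn_integral) (simp cong: measurable_cong_sets)
    fix s t
    have "(\<integral>\<^sup>+w. H (\<lambda>n. - s n + w * a n) \<partial>std_complex_normal)
        = (\<integral>\<^sup>+w. H (\<lambda>n. - s n + - w * a n) \<partial>std_complex_normal)"
      by (rule nn_integral_std_complex_normal_uminus[symmetric]) (rule slice)
    also have "\<dots> = (\<integral>\<^sup>+w. H (\<lambda>n. s n + w * a n) \<partial>std_complex_normal)"
      using even[of "\<lambda>n. s n + w * a n" for w] by simp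
    finally show "(\<integral>\<^sup>+w. H (\<lambda>n. - s n + w * a n) \<partial>std_complex_normal)
        = (\<integral>\<^sup>+w. H (\<lambda>n. s n + w * a n) \<partial>std_complex_normal)" .
    show "(\<integral>\<^sup>+w. H (\<lambda>n. s n + w * a n) \<partial>std_complex_normal)
          * (\<integral>\<^sup>+w. H (\<lambda>n. t n + w * a n) \<partial>std_complex_normal)
        \<le> (\<integral>\<^sup>+w. H (\<lambda>n. (s n + t n) / 2 + w * a n) \<partial>std_complex_normal)\<^sup>2"
    proof (rule prekopa_leindler_std_complex_normal)
      fix x y
      show "H (\<lambda>n. s n + x * a n) * H (\<lambda>n. t n + y * a n)
          \<le> (H (\<lambda>n. (s n + t n) / 2 + (x + y) / 2 * a n))\<^sup>2"
        using lc[of "\<lambda>n. s n + x * a n" "\<lambda>n. t n + y * a n"]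
        by (simp add: add_divide_distrib distrib_right add_ac)
    qed (rule slice)+
  qed
qed

interpretation std_complex_normal: product_sigma_finite "\<lambda>_. std_complex_normal"
  by (simp add: product_sigma_finite_def prob_space_std_complex_normal
      prob_space_imp_sigma_finite)

text \<open>The base point \<open>s\<close> stays a variable although only the origin matters in the
  end: the average must again be a function of the same kind, to which the next Gaussian summand can
  be added.\<close>

definition gaussian_average ::
    "nat set \<Rightarrow> (nat \<Rightarrow> 'i \<Rightarrow> complex) \<Rightarrow> (('i \<Rightarrow> complex) \<Rightarrow> ennreal) \<Rightarrow> ('i \<Rightarrow> complex) \<Rightarrow> ennreal" where
  "gaussian_average I a H s =
     (\<integral>\<^sup>+w. H (\<lambda>n. s n + (\<Sum>k\<in>I. w k * a k n)) \<partial>PiM I (\<lambda>_. std_complex_normal))"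

lemma gaussian_average_integrand_measurable:
  fixes a :: "nat \<Rightarrow> 'i::countable \<Rightarrow> complex"
  assumes "H \<in> borel_measurable borel"
  shows "(\<lambda>w. H (\<lambda>n. s n + (\<Sum>k\<in>I. w k * a k n))) \<in> borel_measurable (PiM I (\<lambda>_. std_complex_normal))"
proof (rule measurable_compose[OF measurable_coordinatewise_then_product assms])
  fix n
  have "(\<lambda>w. w k) \<in> borel_measurable (PiM I (\<lambda>_. std_complex_normal))" if "k \<in> I" for k
    using measurable_component_singleton[OF that, of "\<lambda>_. std_complex_normal"]
    by (simp cong: measurable_cong_sets)
  then show "(\<lambda>w. s n + (\<Sum>k\<in>I. w k * a k n)) \<in> borel_measurable (PiM I (\<lambda>_. std_complex_normal))"
    by (intro borel_measurable_add borel_measurable_sum borel_measurable_times) auto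
qed

text \<open>Tonelli on the product measure integrates the new coordinate last; its contribution
  \<open>w * a i n\<close> then acts as a shift of the base point.\<close>

lemma gaussian_average_insert:
  fixes a :: "nat \<Rightarrow> 'i::countable \<Rightarrow> complex"
  assumes "finite I" "i \<notin> I" "H \<in> borel_measurable borel"
  shows "gaussian_average (insert i I) a H s
     = (\<integral>\<^sup>+w. gaussian_average I a H (\<lambda>n. s n + w * a i n) \<partial>std_complex_normal)"
proof -
  have "(\<Sum>k\<in>insert i I. (w(i := y)) k * a k n) = y * a i n + (\<Sum>k\<in>I. w k * a k n)" for w y n
    using assms by (auto intro!: sum.cong)
  then show ?thesis
    unfolding gaussian_average_def
    by (subst std_complex_normal.product_nn_integral_insert_rev[OF assms(1,2)
          gaussian_average_integrand_measurable[OF assms(3)]])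
       (simp add: add.assoc del: sum.insert fun_upd_apply)
qed

lemma even_log_concave_gaussian_average:
  assumes "finite I" "even_log_concave H"
  shows "even_log_concave (gaussian_average I a H)"
  using assms(1)
proof induction
  case empty
  \<comment> \<open>The empty product is a one-point probability space and the empty sum shifts by
    0.\<close>
  have "gaussian_average {} a H = H"
    by (auto simp: fun_eq_iff gaussian_average_def PiM_empty nn_integral_count_space_finite)
  then show ?case using assms by simp
next
  case (insert i I)
  have "H \<in> borel_measurable borel" using assms by (simp add: even_log_concave_def)
  then have "gaussian_average (insert i I) a H
      = (\<lambda>s. \<integral>\<^sup>+w. gaussian_average I a H (\<lambda>n. s n + w * a i n) \<partial>std_complex_normal)"
    using insert by (simp add: fun_eq_iff gaussian_average_insert)
  then show ?case using even_log_concave_convolution[OF insert.IH] by simp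
qed

text \<open>This is the Anderson step. For each value of the new Gaussian, the average over the
  others is taken at a shifted base point, where it is at most its value at the origin.\<close>

lemma gaussian_average_insert_le:
  assumes "finite I" "i \<notin> I" "even_log_concave H"
  shows "gaussian_average (insert i I) a H (\<lambda>_. 0) \<le> gaussian_average I a H (\<lambda>_. 0)"
proof -
  interpret prob_space std_complex_normal by (rule prob_space_std_complex_normal)
  have "gaussian_average (insert i I) a H (\<lambda>_. 0)
      = (\<integral>\<^sup>+w. gaussian_average I a H (\<lambda>n. 0 + w * a i n) \<partial>std_complex_normal)"
    using assms by (intro gaussian_average_insert) (auto simp: even_log_concave_def)
  also have "\<dots> \<le> (\<integral>\<^sup>+w. gaussian_average I a H (\<lambda>_. 0) \<partial>std_complex_normal)"
    using even_log_concave_gaussian_average[OF assms(1,3)]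
    by (intro nn_integral_mono even_log_concave_le_origin)
  also have "\<dots> = gaussian_average I a H (\<lambda>_. 0)"
    by (simp only: nn_integral_const emeasure_space_1 mult_1_right)
  finally show ?thesis .
qed

subsection \<open>Truncated channels\<close>

text \<open>By independence the first \<open>K\<close> coefficients have the product Gaussian law,
  and \<open>\<eta>\<close> cancels in the normalized gains. The probability thus becomes an
  integral to which the averaging inequalities apply.\<close>

lemma truncated_channel_cdf_eq_gaussian_average:
  assumes "prob_space M" "N > 0" "\<eta> > 0" "0 < K" "K \<le> N"
    and indep: "prob_space.indep_vars M (\<lambda>_. borel) z {..<N}"
    and distr: "\<And>k. k < N \<Longrightarrow> distributed M lborel (z k) std_complex_normal_density"
  shows "max_gain_cdf M N \<eta> (truncated_channel K \<eta> U lam z) x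
    = enn2real (gaussian_average {..<K} (\<lambda>k n. complex_of_real (sqrt (lam k)) * U $$ (n, k))
        (indicator {s. \<forall>n<N. cmod (s n) \<le> sqrt x}) (\<lambda>_. 0))"
proof -
  interpret prob_space M by fact
  define a where "a k n = complex_of_real (sqrt (lam k)) * U $$ (n, k)" for k n
  define C :: "(nat \<Rightarrow> complex) set" where "C = {s. \<forall>n<N. cmod (s n) \<le> sqrt x}"
  define X where "X \<omega> = (\<lambda>k\<in>{..<K}. z k \<omega>)" for \<omega>
  let ?P = "PiM {..<K} (\<lambda>_. borel :: complex measure)"
  have C: "C \<in> sets borel"
  proof -
    have [measurable]: "(\<lambda>s::nat \<Rightarrow> complex. s n) \<in> borel_measurable borel" for n
      by (rule measurable_product_coordinates)
    show ?thesis unfolding C_def by measurable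
  qed
  have rv: "random_variable borel (z k)" if "k < K" for k
    using indep that \<open>K \<le> N\<close> by (auto simp: indep_vars_def)
  have "indep_vars (\<lambda>_. borel) z {..<K}"
    using indep \<open>K \<le> N\<close> by (intro indep_vars_subset[OF indep]) auto
  \<comment> \<open>The characterization of independence by product laws asks for a nonempty index
    set, hence \<open>0 < K\<close>.\<close>
  then have "distr M ?P X = PiM {..<K} (\<lambda>k. distr M borel (z k))"
    using rv \<open>0 < K\<close> by (subst (asm) indep_vars_iff_distr_eq_PiM') (auto simp: X_def[abs_def])
  also have "\<dots> = PiM {..<K} (\<lambda>_. std_complex_normal)"
  proof (rule PiM_cong)
    fix k assume "k \<in> {..<K}"
    \<comment> \<open>The density hypothesis is phrased over \<open>lborel\<close> and independence
      over \<open>borel\<close>; the image measure is the same because only the sigma-algebra of the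
      target enters.\<close>
    then have "distr M lborel (z k) = std_complex_normal"
      using distr[of k] \<open>K \<le> N\<close> by (simp add: distributed_def)
    then show "distr M borel (z k) = std_complex_normal" by (simp cong: distr_cong)
  qed simp
  finally have law: "distr M ?P X = PiM {..<K} (\<lambda>_. std_complex_normal)" .
  have [measurable]: "X \<in> measurable M ?P"
    unfolding X_def using rv by (intro measurable_restrict) auto
  have gain: "(cmod (truncated_channel K \<eta> U lam z n \<omega>))\<^sup>2 / \<eta> \<le> x
      \<longleftrightarrow> cmod (\<Sum>k<K. X \<omega> k * a k n) \<le> sqrt x" for n \<omega>
  proof -
    have "(cmod (truncated_channel K \<eta> U lam z n \<omega>))\<^sup>2 / \<eta> = (cmod (\<Sum>k<K. X \<omega> k * a k n))\<^sup>2"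
      using \<open>\<eta> > 0\<close> by (simp add: truncated_channel_def norm_mult power_mult_distrib a_def X_def mult_ac)
    \<comment> \<open>The function \<open>sqrt\<close> is strictly increasing on all reals, with
      negative values at negative arguments, so no sign condition on \<open>x\<close> is
      required.\<close>
    then show ?thesis using real_sqrt_le_iff[of "(cmod (\<Sum>k<K. X \<omega> k * a k n))\<^sup>2" x] by simp
  qed
  have max_gain: "Max ((\<lambda>n. (cmod (truncated_channel K \<eta> U lam z n \<omega>))\<^sup>2 / \<eta>) ` {..<N}) \<le> x
      \<longleftrightarrow> (\<forall>n<N. cmod (\<Sum>k<K. X \<omega> k * a k n) \<le> sqrt x)" for \<omega>
    using \<open>N > 0\<close> by (subst Max_le_iff) (auto simp: gain lessThan_empty_iff)
  have meas: "(\<lambda>w. indicator C (\<lambda>n. 0 + (\<Sum>k<K. w k * a k n)) :: ennreal) \<in> borel_measurable ?P"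
    using gaussian_average_integrand_measurable[where H="indicator C" and s="\<lambda>_. 0" and I="{..<K}" and a=a] C
    by (simp cong: measurable_cong_sets sets_PiM_cong)
  have "gaussian_average {..<K} a (indicator C) (\<lambda>_. 0)
      = (\<integral>\<^sup>+w. indicator C (\<lambda>n. 0 + (\<Sum>k<K. w k * a k n)) \<partial>distr M ?P X)"
    unfolding gaussian_average_def law ..
  also have "\<dots> = (\<integral>\<^sup>+\<omega>. indicator C (\<lambda>n. 0 + (\<Sum>k<K. X \<omega> k * a k n)) \<partial>M)"
    using meas by (intro nn_integral_distr) auto
  also have "\<dots> = (\<integral>\<^sup>+\<omega>. indicator {\<omega>\<in>space M. (\<lambda>n. 0 + (\<Sum>k<K. X \<omega> k * a k n)) \<in> C} \<omega> \<partial>M)"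
    by (intro nn_integral_cong) (auto simp: indicator_def)
  also have "\<dots> = emeasure M {\<omega>\<in>space M. (\<lambda>n. 0 + (\<Sum>k<K. X \<omega> k * a k n)) \<in> C}"
  proof (rule nn_integral_indicator)
    \<comment> \<open>The event is measurable as the preimage of 1 under this indicator.\<close>
    have "(\<lambda>\<omega>. indicator C (\<lambda>n. 0 + (\<Sum>k<K. X \<omega> k * a k n)) :: ennreal) \<in> borel_measurable M"
      by (rule measurable_compose[OF _ meas]) measurable
    then have "(\<lambda>\<omega>. indicator C (\<lambda>n. 0 + (\<Sum>k<K. X \<omega> k * a k n)) :: ennreal) -` {1} \<inter> space M \<in> sets M"
      by (rule measurable_sets) simp
    also have "(\<lambda>\<omega>. indicator C (\<lambda>n. 0 + (\<Sum>k<K. X \<omega> k * a k n)) :: ennreal) -` {1} \<inter> space M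
        = {\<omega>\<in>space M. (\<lambda>n. 0 + (\<Sum>k<K. X \<omega> k * a k n)) \<in> C}"
      by (auto simp: indicator_def split: if_splits)
    finally show "{\<omega>\<in>space M. (\<lambda>n. 0 + (\<Sum>k<K. X \<omega> k * a k n)) \<in> C} \<in> sets M" .
  qed
  also have "{\<omega>\<in>space M. (\<lambda>n. 0 + (\<Sum>k<K. X \<omega> k * a k n)) \<in> C} = {\<omega> \<in> space M.
      Max ((\<lambda>n. (cmod (truncated_channel K \<eta> U lam z n \<omega>))\<^sup>2 / \<eta>) ` {..<N}) \<le> x}"
    by (simp add: C_def max_gain)
  finally show ?thesis
    unfolding max_gain_cdf_def measure_def a_def[abs_def] C_def by simp
qed

text \<open>Passing from \<open>K\<close> to \<open>L\<close> adds independent Gaussian summands one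
  at a time, and each can only lower the probability of the event. That event is a polydisc in the
  first \<open>N\<close> coordinates with the others free, hence symmetric and convex.\<close>

lemma truncated_channel_cdf_antimono:
  assumes "prob_space M" "N > 0" "\<eta> > 0" "0 < K" "K \<le> L" "L \<le> N"
    and "prob_space.indep_vars M (\<lambda>_. borel) z {..<N}"
    and "\<And>k. k < N \<Longrightarrow> distributed M lborel (z k) std_complex_normal_density"
  shows "max_gain_cdf M N \<eta> (truncated_channel L \<eta> U lam z) x
    \<le> max_gain_cdf M N \<eta> (truncated_channel K \<eta> U lam z) x"
proof -
  define a where "a k n = complex_of_real (sqrt (lam k)) * U $$ (n, k)" for k n
  define C :: "(nat \<Rightarrow> complex) set" where "C = {s. \<forall>n<N. cmod (s n) \<le> sqrt x}"
  have "even_log_concave (indicator C)"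
  proof (rule even_log_concave_indicator)
    have [measurable]: "(\<lambda>s::nat \<Rightarrow> complex. s n) \<in> borel_measurable borel" for n
      by (rule measurable_product_coordinates)
    show "C \<in> sets borel" unfolding C_def by measurable
    show "(\<lambda>n. (s n + t n) / 2) \<in> C" if "s \<in> C" "t \<in> C" for s t
      unfolding C_def
    proof safe
      fix n assume "n < N"
      then show "cmod ((s n + t n) / 2) \<le> sqrt x"
        using that norm_triangle_ineq[of "s n" "t n"] by (force simp: C_def norm_divide)
    qed
  qed (auto simp: C_def)
  then have "gaussian_average {..<Suc m} a (indicator C) (\<lambda>_. 0)
      \<le> gaussian_average {..<m} a (indicator C) (\<lambda>_. 0)" for m
    unfolding lessThan_Suc by (intro gaussian_average_insert_le) auto
  then have "gaussian_average {..<L} a (indicator C) (\<lambda>_. 0)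
      \<le> gaussian_average {..<K} a (indicator C) (\<lambda>_. 0)"
    using \<open>K \<le> L\<close> by (rule lift_Suc_antimono_le)
  \<comment> \<open>Finiteness of the larger side is what lets the inequality pass through
    \<open>enn2real\<close>, which sends infinity to 0.\<close>
  moreover have "gaussian_average {..<K} a (indicator C) (\<lambda>_. 0) < \<infinity>"
  proof -
    interpret product_prob_space "\<lambda>_. std_complex_normal" "{..<K}"
      by (intro product_prob_spaceI prob_space_std_complex_normal)
    have "gaussian_average {..<K} a (indicator C) (\<lambda>_. 0)
        \<le> (\<integral>\<^sup>+w. 1 \<partial>PiM {..<K} (\<lambda>_. std_complex_normal))"
      unfolding gaussian_average_def by (intro nn_integral_mono) (auto simp: indicator_def)
    also have "\<dots> < \<infinity>" by (simp only: nn_integral_const P.emeasure_space_1) simp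
    finally show ?thesis .
  qed
  ultimately show ?thesis
    using assms by (simp add: truncated_channel_cdf_eq_gaussian_average enn2real_mono
        flip: a_def[abs_def] C_def)
qed

theorem theorem1:
  fixes M :: "'a measure" and N K :: nat and W \<eta> :: real
    and U :: "complex mat" and lam :: "nat \<Rightarrow> real" and z :: "nat \<Rightarrow> 'a \<Rightarrow> complex"
  assumes "prob_space M"
    and "N \<ge> 2" and "W > 0" and "\<eta> > 0"
    and "psd_eigendecomposition N (jakes_matrix N W) U lam"
    and "prob_space.indep_vars M (\<lambda>_. borel) z {..<N}"
    and "\<And>k. k < N \<Longrightarrow> distributed M lborel (z k) std_complex_normal_density"
    and "K \<in> {1..N}"
  shows "(\<forall>x>0. max_gain_cdf M N \<eta> (truncated_channel K \<eta> U lam z) x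
                  \<ge> max_gain_cdf M N \<eta> (channel N \<eta> U lam z) x) \<and>
         (\<forall>\<gamma>\<^sub>t\<^sub>h>0. \<forall>\<gamma>\<^sub>a\<^sub>v>0.
            outage_prob M N \<eta> (truncated_channel K \<eta> U lam z) \<gamma>\<^sub>t\<^sub>h \<gamma>\<^sub>a\<^sub>v
              \<ge> outage_prob M N \<eta> (channel N \<eta> U lam z) \<gamma>\<^sub>t\<^sub>h \<gamma>\<^sub>a\<^sub>v)"
proof -
  \<comment> \<open>The full channel is the truncation of order \<open>N\<close>, so the claim
    compares the orders \<open>K\<close> and \<open>N\<close>; outage probabilities are the same
    distribution functions at the ratio of the two SNR values.\<close>
  have "channel N \<eta> U lam z = truncated_channel N \<eta> U lam z"
    by (simp add: fun_eq_iff channel_def truncated_channel_def)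
  then have "max_gain_cdf M N \<eta> (channel N \<eta> U lam z) x
      \<le> max_gain_cdf M N \<eta> (truncated_channel K \<eta> U lam z) x" for x
    using truncated_channel_cdf_antimono[of M N \<eta> K N z U lam x] assms by auto
  then show ?thesis by (simp add: outage_prob_def)
qed

end
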